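(* The following data form a bicategory, denoted $\mathrm{Eng}$. The $0$-cells are the types, the $1$-cells $N_1\to N_2$ are the aspects $V\colon N_1\to N_2$, and the $2$-cells $V_1\Rightarrow V_2$ are the facts $F\colon V_1\Rightarrow V_2$, equipped with the following compositions: (i) vertical composition of facts $F_1\colon V_1\Rightarrow V_2$ and $F_2\colon V_2\Rightarrow V_3$ between aspects $N_1\to N_2$: the fact $F_2\circ F_1\colon V_1\Rightarrow V_3$ with author set $F_1\cap F_2$, i.e. $F_1\cap F_2\models[\mathcal V_1\simeq\mathcal V_3]$; the identity fact of $V$ is the one with author set $\mathrm{Auth}(V)$; (ii) horizontal composition of aspects $V=(\mathcal V,\mathrm{Auth}(V))\colon N_1\to N_2$ and $V'=(\mathcal V',\mathrm{Auth}(V'))\colon N_2\to N_3$: the aspect $V;V'=(\mathcal V;\mathcal V',\ \mathrm{Auth}(V)\cap\mathrm{Auth}(V'))\colon N_1\to N_3$, where $\mathcal V;\mathcal V'$ is the concatenation through $\mathcal N_2$; the identity aspect of a type $N$ is $\mathrm{id}_N=(e,\mathrm{Auth}(N))$; (iii) horizontal composition of facts $F\colon V_1\Rightarrow V_2$ (between aspects $N_1\to N_2$) and $F'\colon V_1'\Rightarrow V_2'$ (between aspects $N_2\to N_3$): the fact $F\bullet F'\colon V_1;V_1'\Rightarrow V_2;V_2'$ with author set $F\cap F'$, i.e. $F\cap F'\models[(\mathcal V_1;\mathcal V_1')\simeq(\mathcal V_2;\mathcal V_2')]$. The associativity constraints are identities, and the unit constraints $V;\mathrm{id}_{N_2}\Rightarrow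 V$ and $\mathrm{id}_{N_1};V\Rightarrow V$ are the facts with author set $\mathrm{Auth}(V)$.
   Context: Primitive data and postulates. Fix a collection of authors, a collection of noun phrases and a collection of verb phrases; phrases are strings of words. A sentence is a triple $\Sigma=(\mathcal N_1,\mathcal V,\mathcal N_2)$ with $\mathcal N_1,\mathcal N_2$ noun phrases and $\mathcal V$ a verb phrase. Given sentences $\Sigma_1=(\mathcal N_1,\mathcal V_1,\mathcal N_2)$ and $\Sigma_2=(\mathcal N_2,\mathcal V_2,\mathcal N_3)$ (concatenatable sentences), $\mathcal V_1;\mathcal V_2$ is the verb phrase given by the string "$\mathcal V_1\ \mathcal N_2$ which $\mathcal V_2$", and the concatenation is $\Sigma_1;\Sigma_2=(\mathcal N_1,\mathcal V_1;\mathcal V_2,\mathcal N_3)$. Since this is string concatenation, $(\mathcal V_1;\mathcal V_2);\mathcal V_3=\mathcal V_1;(\mathcal V_2;\mathcal V_3)$. Endorsement. An author $s$ may endorse a noun phrase, $s\models\mathcal N$; then $\mathcal N$ refers, for $s$, to a set $\mathrm{Ex}_s(\mathcal N)$ of examples. An author with $s\models\mathcal N_1$ and $s\models\mathcal N_2$ may endorse a sentence $\Sigma=(\mathcal N_1,\mathcal V,\mathcal N_2)$, written $s\models\Sigma$ or $s\models\mathcal V$; then $\Sigma$ refers, for $s$, to a function $\varphi_s(\Sigma)\colon\mathrm{Ex}_s(\mathcal N_1)\to\mathrm{Ex}_s(\mathcal N_2)$. If $s$ endorses $\Sigma=(\mathcal N_1,\mathcal V,\mathcal N_2)$ and $\Sigma'=(\mathcal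 N_1,\mathcal V',\mathcal N_2)$, then $s$ endorses their equivalence, $s\models[\Sigma\simeq\Sigma']$ (also written $s\models[\mathcal V\simeq\mathcal V']$), if and only if $\varphi_s(\Sigma)=\varphi_s(\Sigma')$ (the two sentences refer to the same functional relationship). Postulates. (1) If $\Sigma_1,\Sigma_2$ are concatenatable, $s\models\Sigma_1$ and $s\models\Sigma_2$, then $s\models\Sigma_1;\Sigma_2$, and $\varphi_s(\Sigma_1;\Sigma_2)$ is the composite function "first $\varphi_s(\Sigma_1)$, then $\varphi_s(\Sigma_2)$". (2) There is a unique verb phrase $e$ ("is of course") such that $s\models(\mathcal N,e,\mathcal N)$ whenever $s\models\mathcal N$; moreover $\varphi_s(\mathcal N,e,\mathcal N)$ is the identity function. (3) For every sentence $\Sigma=(\mathcal N_1,\mathcal V,\mathcal N_2)$ with $s\models\Sigma$ one has $s\models[\Sigma;(\mathcal N_2,e,\mathcal N_2)\simeq\Sigma]$ and $s\models[(\mathcal N_1,e,\mathcal N_1);\Sigma\simeq\Sigma]$. An author set is a (possibly empty) set of authors; it endorses something if each of its members does. A type is a pair $N=(\mathcal N,T)$ with $\mathcal N$ a noun phrase and $T=\mathrm{Auth}(N)$ an author set with $T\models\mathcal N$. An aspect $V\colon N_1\to N_2$ between types is a pair $V=(\mathcal V,A)$ with $\mathcal V$ a verb phrase and $A=\mathrm{Auth}(V)\subseteq\mathrm{Auth}(N_1)\cap\mathrm{Auth}(N_2)$ an author set with $A\models(\mathcal N_1,\mathcal V,\mathcal N_2)$. A fact $F\colon V_1\Rightarrow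 V_2$ between aspects $V_1,V_2\colon N_1\to N_2$ is an author set $F\subseteq\mathrm{Auth}(V_1)\cap\mathrm{Auth}(V_2)$ with $F\models[\mathcal V_1\simeq\mathcal V_2]$. Collections of cells are allowed to be large. *)

theory Defs
  imports "HOL-Library.FuncSet"
begin

text \<open>
  A 1-cell carries its source and target 0-cell, and a 2-cell its source and target 1-cell.
  Horizontal composition is written in diagrammatic order (f followed by g is
  \<open>f \<star> g\<close>), vertical composition in applicative order (\<open>\<beta> \<cdot> \<alpha>\<close> is
  \<open>\<alpha>\<close> followed by \<open>\<beta>\<close>).  All operations are relevant only where their
  arguments are composable.
\<close>

record ('o, 'h, 'c) bicat_data =
  Obj :: "'o set"
  Arr :: "'h set"
  Cell :: "'c set"
  src1 :: "'h \<Rightarrow> 'o"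
  trg1 :: "'h \<Rightarrow> 'o"
  src2 :: "'c \<Rightarrow> 'h"
  trg2 :: "'c \<Rightarrow> 'h"
  vid :: "'h \<Rightarrow> 'c"
  vcomp :: "'c \<Rightarrow> 'c \<Rightarrow> 'c"  (infixr "\<cdot>\<index>" 60)
  hid :: "'o \<Rightarrow> 'h"
  hcomp1 :: "'h \<Rightarrow> 'h \<Rightarrow> 'h"  (infixr "\<star>\<index>" 70)
  hcomp2 :: "'c \<Rightarrow> 'c \<Rightarrow> 'c"  (infixr "\<bullet>\<index>" 70)
  assoc :: "'h \<Rightarrow> 'h \<Rightarrow> 'h \<Rightarrow> 'c"
  lunit :: "'h \<Rightarrow> 'c"
  runit :: "'h \<Rightarrow> 'c"

definition hom1 :: "('o, 'h, 'c) bicat_data \<Rightarrow> 'o \<Rightarrow> 'o \<Rightarrow> 'h set" where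
  "hom1 B a b = {f \<in> Arr B. src1 B f = a \<and> trg1 B f = b}"

definition hom2 :: "('o, 'h, 'c) bicat_data \<Rightarrow> 'h \<Rightarrow> 'h \<Rightarrow> 'c set" where
  "hom2 B f g = {\<alpha> \<in> Cell B. src2 B \<alpha> = f \<and> trg2 B \<alpha> = g}"

definition iso2 :: "('o, 'h, 'c) bicat_data \<Rightarrow> 'h \<Rightarrow> 'h \<Rightarrow> 'c set" where
  "iso2 B f g =
    {\<alpha> \<in> hom2 B f g. \<exists>\<beta> \<in> hom2 B g f. \<beta> \<cdot>\<^bsub>B\<^esub> \<alpha> = vid B f \<and> \<alpha> \<cdot>\<^bsub>B\<^esub> \<beta> = vid B g}"

locale bicategory =
  fixes B :: "('o, 'h, 'c) bicat_data" (structure)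
  assumes src1_obj: "f \<in> Arr B \<Longrightarrow> src1 B f \<in> Obj B"
    and trg1_obj: "f \<in> Arr B \<Longrightarrow> trg1 B f \<in> Obj B"
    and src2_arr: "\<alpha> \<in> Cell B \<Longrightarrow> src2 B \<alpha> \<in> Arr B"
    and trg2_arr: "\<alpha> \<in> Cell B \<Longrightarrow> trg2 B \<alpha> \<in> Arr B"
    and parallel_src: "\<alpha> \<in> Cell B \<Longrightarrow> src1 B (src2 B \<alpha>) = src1 B (trg2 B \<alpha>)"
    and parallel_trg: "\<alpha> \<in> Cell B \<Longrightarrow> trg1 B (src2 B \<alpha>) = trg1 B (trg2 B \<alpha>)"
    and vid_cell: "f \<in> Arr B \<Longrightarrow> vid B f \<in> hom2 B f f"
    and vcomp_cell: "\<lbrakk>\<alpha> \<in> hom2 B f g; \<beta> \<in> hom2 B g h\<rbrakk> \<Longrightarrow> \<beta> \<cdot> \<alpha> \<in> hom2 B f h"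
    and vcomp_vid_right: "\<alpha> \<in> hom2 B f g \<Longrightarrow> \<alpha> \<cdot> vid B f = \<alpha>"
    and vcomp_vid_left: "\<alpha> \<in> hom2 B f g \<Longrightarrow> vid B g \<cdot> \<alpha> = \<alpha>"
    and vcomp_assoc: "\<lbrakk>\<alpha> \<in> hom2 B f g; \<beta> \<in> hom2 B g h; \<gamma> \<in> hom2 B h k\<rbrakk>
      \<Longrightarrow> (\<gamma> \<cdot> \<beta>) \<cdot> \<alpha> = \<gamma> \<cdot> (\<beta> \<cdot> \<alpha>)"
    and hid_arr: "a \<in> Obj B \<Longrightarrow> hid B a \<in> hom1 B a a"
    and hcomp1_arr: "\<lbrakk>f \<in> hom1 B a b; g \<in> hom1 B b c\<rbrakk> \<Longrightarrow> f \<star> g \<in> hom1 B a c"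
    and hcomp2_cell: "\<lbrakk>f \<in> hom1 B a b; g \<in> hom1 B b c; \<alpha> \<in> hom2 B f f'; \<beta> \<in> hom2 B g g'\<rbrakk>
      \<Longrightarrow> \<alpha> \<bullet> \<beta> \<in> hom2 B (f \<star> g) (f' \<star> g')"
    and hcomp2_vid: "\<lbrakk>f \<in> hom1 B a b; g \<in> hom1 B b c\<rbrakk> \<Longrightarrow> vid B f \<bullet> vid B g = vid B (f \<star> g)"
    and interchange: "\<lbrakk>f \<in> hom1 B a b; g \<in> hom1 B b c;
        \<alpha> \<in> hom2 B f f'; \<alpha>' \<in> hom2 B f' f''; \<beta> \<in> hom2 B g g'; \<beta>' \<in> hom2 B g' g''\<rbrakk>
      \<Longrightarrow> (\<alpha>' \<cdot> \<alpha>) \<bullet> (\<beta>' \<cdot> \<beta>) = (\<alpha>' \<bullet> \<beta>') \<cdot> (\<alpha> \<bullet> \<beta>)"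
    and assoc_iso: "\<lbrakk>f \<in> hom1 B a b; g \<in> hom1 B b c; h \<in> hom1 B c d\<rbrakk>
      \<Longrightarrow> assoc B f g h \<in> iso2 B ((f \<star> g) \<star> h) (f \<star> (g \<star> h))"
    and assoc_natural: "\<lbrakk>f \<in> hom1 B a b; g \<in> hom1 B b c; h \<in> hom1 B c d;
        \<alpha> \<in> hom2 B f f'; \<beta> \<in> hom2 B g g'; \<gamma> \<in> hom2 B h h'\<rbrakk>
      \<Longrightarrow> assoc B f' g' h' \<cdot> ((\<alpha> \<bullet> \<beta>) \<bullet> \<gamma>) = (\<alpha> \<bullet> (\<beta> \<bullet> \<gamma>)) \<cdot> assoc B f g h"
    and lunit_iso: "f \<in> hom1 B a b \<Longrightarrow> lunit B f \<in> iso2 B (hid B a \<star> f) f"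
    and lunit_natural: "\<lbrakk>f \<in> hom1 B a b; \<alpha> \<in> hom2 B f f'\<rbrakk>
      \<Longrightarrow> lunit B f' \<cdot> (vid B (hid B a) \<bullet> \<alpha>) = \<alpha> \<cdot> lunit B f"
    and runit_iso: "f \<in> hom1 B a b \<Longrightarrow> runit B f \<in> iso2 B (f \<star> hid B b) f"
    and runit_natural: "\<lbrakk>f \<in> hom1 B a b; \<alpha> \<in> hom2 B f f'\<rbrakk>
      \<Longrightarrow> runit B f' \<cdot> (\<alpha> \<bullet> vid B (hid B b)) = \<alpha> \<cdot> runit B f"
    and pentagon: "\<lbrakk>f \<in> hom1 B a b; g \<in> hom1 B b c; h \<in> hom1 B c d; k \<in> hom1 B d e\<rbrakk>
      \<Longrightarrow> (vid B f \<bullet> assoc B g h k) \<cdot> (assoc B f (g \<star> h) k \<cdot> (assoc B f g h \<bullet> vid B k))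
        = assoc B f g (h \<star> k) \<cdot> assoc B (f \<star> g) h k"
    and triangle: "\<lbrakk>f \<in> hom1 B a b; g \<in> hom1 B b c\<rbrakk>
      \<Longrightarrow> (vid B f \<bullet> lunit B g) \<cdot> assoc B f (hid B b) g = runit B f \<bullet> vid B g"

type_synonym 'w phrase = "'w list"

type_synonym 'w sentence = "'w phrase \<times> 'w phrase \<times> 'w phrase"

text \<open>
  \<open>which\<close> is the word ``which'', and \<open>is_of_course\<close> is the verb phrase e.  Examples live in one
  universe \<open>'x\<close>; \<open>\<phi> s \<Sigma>\<close> is a function between example sets in the sense of
  \<open>\<rightarrow>\<^sub>E\<close>, so that equality of such functions is plain equality.
\<close>

record ('a, 'w, 'x) english_data =
  Authors :: "'a set"
  Nouns :: "'w phrase set"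
  Verbs :: "'w phrase set"
  which :: 'w
  is_of_course :: "'w phrase"
  endorses_noun :: "'a \<Rightarrow> 'w phrase \<Rightarrow> bool"
  Examples :: "'a \<Rightarrow> 'w phrase \<Rightarrow> 'x set"
  endorses :: "'a \<Rightarrow> 'w sentence \<Rightarrow> bool"
  \<phi> :: "'a \<Rightarrow> 'w sentence \<Rightarrow> 'x \<Rightarrow> 'x"
  endorses_equiv :: "'a \<Rightarrow> 'w sentence \<Rightarrow> 'w sentence \<Rightarrow> bool"

definition Sentences :: "('a, 'w, 'x) english_data \<Rightarrow> 'w sentence set" where
  "Sentences D = Nouns D \<times> Verbs D \<times> Nouns D"

definition concat_verb ::
    "('a, 'w, 'x) english_data \<Rightarrow> 'w phrase \<Rightarrow> 'w phrase \<Rightarrow> 'w phrase \<Rightarrow> 'w phrase" where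
  "concat_verb D v1 n v2 = v1 @ n @ [which D] @ v2"

locale english =
  fixes D :: "('a, 'w, 'x) english_data"
  assumes concat_verb_closed:
      "\<lbrakk>(n1, v1, n2) \<in> Sentences D; (n2, v2, n3) \<in> Sentences D\<rbrakk>
        \<Longrightarrow> concat_verb D v1 n2 v2 \<in> Verbs D"
    and endorses_nouns:
      "\<lbrakk>s \<in> Authors D; (n1, v, n2) \<in> Sentences D; endorses D s (n1, v, n2)\<rbrakk>
        \<Longrightarrow> endorses_noun D s n1 \<and> endorses_noun D s n2"
    and \<phi>_function:
      "\<lbrakk>s \<in> Authors D; (n1, v, n2) \<in> Sentences D; endorses D s (n1, v, n2)\<rbrakk>
        \<Longrightarrow> \<phi> D s (n1, v, n2) \<in> Examples D s n1 \<rightarrow>\<^sub>E Examples D s n2"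
    and endorses_equiv_iff:
      "\<lbrakk>s \<in> Authors D; (n1, v, n2) \<in> Sentences D; (n1, v', n2) \<in> Sentences D;
        endorses D s (n1, v, n2); endorses D s (n1, v', n2)\<rbrakk>
        \<Longrightarrow> endorses_equiv D s (n1, v, n2) (n1, v', n2) \<longleftrightarrow>
            \<phi> D s (n1, v, n2) = \<phi> D s (n1, v', n2)"
    and endorses_concat:
      "\<lbrakk>s \<in> Authors D; (n1, v1, n2) \<in> Sentences D; (n2, v2, n3) \<in> Sentences D;
        endorses D s (n1, v1, n2); endorses D s (n2, v2, n3)\<rbrakk>
        \<Longrightarrow> endorses D s (n1, concat_verb D v1 n2 v2, n3) \<and>
            \<phi> D s (n1, concat_verb D v1 n2 v2, n3) =
              compose (Examples D s n1) (\<phi> D s (n2, v2, n3)) (\<phi> D s (n1, v1, n2))"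
    and is_of_course_unique:
      "v \<in> Verbs D \<and>
        (\<forall>s \<in> Authors D. \<forall>n \<in> Nouns D. endorses_noun D s n \<longrightarrow> endorses D s (n, v, n))
        \<longleftrightarrow> v = is_of_course D"
    and \<phi>_is_of_course:
      "\<lbrakk>s \<in> Authors D; n \<in> Nouns D; endorses_noun D s n\<rbrakk>
        \<Longrightarrow> \<phi> D s (n, is_of_course D, n) = (\<lambda>x \<in> Examples D s n. x)"
    and is_of_course_right:
      "\<lbrakk>s \<in> Authors D; (n1, v, n2) \<in> Sentences D; endorses D s (n1, v, n2)\<rbrakk>
        \<Longrightarrow> endorses_equiv D s (n1, concat_verb D v n2 (is_of_course D), n2) (n1, v, n2)"
    and is_of_course_left:
      "\<lbrakk>s \<in> Authors D; (n1, v, n2) \<in> Sentences D; endorses D s (n1, v, n2)\<rbrakk>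
        \<Longrightarrow> endorses_equiv D s (n1, concat_verb D (is_of_course D) n1 v, n2) (n1, v, n2)"

datatype ('a, 'w) eng_type = Type (noun: "'w phrase") (type_auth: "'a set")

datatype ('a, 'w) aspect =
  Aspect (asp_src: "('a, 'w) eng_type") (asp_trg: "('a, 'w) eng_type")
         (verb: "'w phrase") (asp_auth: "'a set")

datatype ('a, 'w) fact =
  Fact (fact_src: "('a, 'w) aspect") (fact_trg: "('a, 'w) aspect") (fact_auth: "'a set")

definition asp_sentence :: "('a, 'w) aspect \<Rightarrow> 'w sentence" where
  "asp_sentence V = (noun (asp_src V), verb V, noun (asp_trg V))"

definition Types :: "('a, 'w, 'x) english_data \<Rightarrow> ('a, 'w) eng_type set" where
  "Types D = {N. noun N \<in> Nouns D \<and> type_auth N \<subseteq> Authors D \<and>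
     (\<forall>s \<in> type_auth N. endorses_noun D s (noun N))}"

definition Aspects :: "('a, 'w, 'x) english_data \<Rightarrow> ('a, 'w) aspect set" where
  "Aspects D = {V. asp_src V \<in> Types D \<and> asp_trg V \<in> Types D \<and> verb V \<in> Verbs D \<and>
     asp_auth V \<subseteq> type_auth (asp_src V) \<inter> type_auth (asp_trg V) \<and>
     (\<forall>s \<in> asp_auth V. endorses D s (asp_sentence V))}"

definition Facts :: "('a, 'w, 'x) english_data \<Rightarrow> ('a, 'w) fact set" where
  "Facts D = {F. fact_src F \<in> Aspects D \<and> fact_trg F \<in> Aspects D \<and>
     asp_src (fact_src F) = asp_src (fact_trg F) \<and>
     asp_trg (fact_src F) = asp_trg (fact_trg F) \<and>
     fact_auth F \<subseteq> asp_auth (fact_src F) \<inter> asp_auth (fact_trg F) \<and>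
     (\<forall>s \<in> fact_auth F.
        endorses_equiv D s (asp_sentence (fact_src F)) (asp_sentence (fact_trg F)))}"

definition id_aspect ::
    "('a, 'w, 'x) english_data \<Rightarrow> ('a, 'w) eng_type \<Rightarrow> ('a, 'w) aspect" where
  "id_aspect D N = Aspect N N (is_of_course D) (type_auth N)"

definition comp_aspect :: "('a, 'w, 'x) english_data
    \<Rightarrow> ('a, 'w) aspect \<Rightarrow> ('a, 'w) aspect \<Rightarrow> ('a, 'w) aspect" where
  "comp_aspect D V V' = Aspect (asp_src V) (asp_trg V')
     (concat_verb D (verb V) (noun (asp_trg V)) (verb V')) (asp_auth V \<inter> asp_auth V')"

definition id_fact :: "('a, 'w) aspect \<Rightarrow> ('a, 'w) fact" where
  "id_fact V = Fact V V (asp_auth V)"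

definition vcomp_fact :: "('a, 'w) fact \<Rightarrow> ('a, 'w) fact \<Rightarrow> ('a, 'w) fact" where
  "vcomp_fact F2 F1 = Fact (fact_src F1) (fact_trg F2) (fact_auth F1 \<inter> fact_auth F2)"

definition hcomp_fact :: "('a, 'w, 'x) english_data
    \<Rightarrow> ('a, 'w) fact \<Rightarrow> ('a, 'w) fact \<Rightarrow> ('a, 'w) fact" where
  "hcomp_fact D F F' = Fact (comp_aspect D (fact_src F) (fact_src F'))
     (comp_aspect D (fact_trg F) (fact_trg F')) (fact_auth F \<inter> fact_auth F')"

text \<open>
  The associator is by definition an identity 2-cell on \<open>(V;V');V''\<close>; that its target is
  \<open>V;(V';V'')\<close> is part of the axiom \<open>assoc_iso\<close> of a bicategory.
\<close>

definition Eng :: "('a, 'w, 'x) english_data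
    \<Rightarrow> (('a, 'w) eng_type, ('a, 'w) aspect, ('a, 'w) fact) bicat_data" where
  "Eng D = \<lparr>
     Obj = Types D,
     Arr = Aspects D,
     Cell = Facts D,
     src1 = asp_src,
     trg1 = asp_trg,
     src2 = fact_src,
     trg2 = fact_trg,
     vid = id_fact,
     vcomp = vcomp_fact,
     hid = id_aspect D,
     hcomp1 = comp_aspect D,
     hcomp2 = hcomp_fact D,
     assoc = (\<lambda>V V' V''. id_fact (comp_aspect D (comp_aspect D V V') V'')),
     lunit = (\<lambda>V. Fact (comp_aspect D (id_aspect D (asp_src V)) V) V (asp_auth V)),
     runit = (\<lambda>V. Fact (comp_aspect D V (id_aspect D (asp_trg V))) V (asp_auth V)) \<rparr>"

end

theory Submission
  imports Defs
begin

text \<open>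
  A fact is determined by its source, its target and its author set, so every equation between
  2-cells reduces to an equation between finite intersections of author sets.  The content
  therefore lies in the closure of facts under the operations, which holds because endorsing an
  equivalence means equality of the functions referred to, and concatenation refers to
  composition.
\<close>

text \<open>Both bracketings spell the same string of words and intersect the same author sets. This
  strict equality is what lets an identity fact serve as the associator.\<close>

lemma comp_aspect_assoc:
  "comp_aspect D (comp_aspect D V V') V'' = comp_aspect D V (comp_aspect D V' V'')"
  by (simp add: comp_aspect_def concat_verb_def Int_assoc)

lemma comp_aspect_sel [simp]:
  "asp_src (comp_aspect D V V') = asp_src V"
  "asp_trg (comp_aspect D V V') = asp_trg V'"
  "asp_auth (comp_aspect D V V') = asp_auth V \<inter> asp_auth V'"
  by (simp_all add: comp_aspect_def)

lemma id_aspect_sel [simp]: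
  "asp_src (id_aspect D N) = N"
  "asp_trg (id_aspect D N) = N"
  "asp_auth (id_aspect D N) = type_auth N"
  by (simp_all add: id_aspect_def)

lemma id_fact_sel [simp]:
  "fact_src (id_fact V) = V" "fact_trg (id_fact V) = V" "fact_auth (id_fact V) = asp_auth V"
  by (simp_all add: id_fact_def)

lemma vcomp_fact_sel [simp]:
  "fact_src (vcomp_fact F2 F1) = fact_src F1"
  "fact_trg (vcomp_fact F2 F1) = fact_trg F2"
  "fact_auth (vcomp_fact F2 F1) = fact_auth F1 \<inter> fact_auth F2"
  by (simp_all add: vcomp_fact_def)

lemma hcomp_fact_sel [simp]:
  "fact_src (hcomp_fact D F F') = comp_aspect D (fact_src F) (fact_src F')"
  "fact_trg (hcomp_fact D F F') = comp_aspect D (fact_trg F) (fact_trg F')"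
  "fact_auth (hcomp_fact D F F') = fact_auth F \<inter> fact_auth F'"
  by (simp_all add: hcomp_fact_def)

lemma Eng_sel [simp]:
  "Obj (Eng D) = Types D" "Arr (Eng D) = Aspects D" "Cell (Eng D) = Facts D"
  "src1 (Eng D) = asp_src" "trg1 (Eng D) = asp_trg"
  "src2 (Eng D) = fact_src" "trg2 (Eng D) = fact_trg"
  "vid (Eng D) = id_fact" "vcomp (Eng D) = vcomp_fact" "hid (Eng D) = id_aspect D"
  "hcomp1 (Eng D) = comp_aspect D" "hcomp2 (Eng D) = hcomp_fact D"
  "assoc (Eng D) V V' V'' = id_fact (comp_aspect D (comp_aspect D V V') V'')"
  "lunit (Eng D) V = Fact (comp_aspect D (id_aspect D (asp_src V)) V) V (asp_auth V)"
  "runit (Eng D) V = Fact (comp_aspect D V (id_aspect D (asp_trg V))) V (asp_auth V)"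
  by (simp_all add: Eng_def)

lemma hom1_Eng: "V \<in> hom1 (Eng D) M N \<longleftrightarrow> V \<in> Aspects D \<and> asp_src V = M \<and> asp_trg V = N"
  by (simp add: hom1_def)

lemma hom2_Eng: "F \<in> hom2 (Eng D) V V' \<longleftrightarrow> F \<in> Facts D \<and> fact_src F = V \<and> fact_trg F = V'"
  by (simp add: hom2_def)

lemma Aspects_auth:
  assumes "V \<in> Aspects D"
  shows "asp_auth V \<subseteq> type_auth (asp_src V)" "asp_auth V \<subseteq> type_auth (asp_trg V)"
  using assms by (auto simp: Aspects_def)

lemma Aspects_endpoints:
  assumes "V \<in> Aspects D"
  shows "asp_src V \<in> Types D" "asp_trg V \<in> Types D"
  using assms by (auto simp: Aspects_def)

lemma Aspects_endorses:
  assumes "V \<in> Aspects D" "s \<in> asp_auth V"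
  shows "s \<in> Authors D" "asp_sentence V \<in> Sentences D" "endorses D s (asp_sentence V)"
  using assms by (auto simp: Aspects_def Types_def Sentences_def asp_sentence_def)

lemma Facts_auth:
  assumes "F \<in> Facts D"
  shows "fact_auth F \<subseteq> asp_auth (fact_src F)" "fact_auth F \<subseteq> asp_auth (fact_trg F)"
  using assms by (auto simp: Facts_def)

lemma Facts_endpoints:
  assumes "F \<in> Facts D"
  shows "fact_src F \<in> Aspects D" "fact_trg F \<in> Aspects D"
    "asp_src (fact_src F) = asp_src (fact_trg F)" "asp_trg (fact_src F) = asp_trg (fact_trg F)"
  using assms by (auto simp: Facts_def)

context english
begin

lemma Facts_iff:
  "F \<in> Facts D \<longleftrightarrow> fact_src F \<in> Aspects D \<and> fact_trg F \<in> Aspects D \<and>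
     asp_src (fact_src F) = asp_src (fact_trg F) \<and>
     asp_trg (fact_src F) = asp_trg (fact_trg F) \<and>
     fact_auth F \<subseteq> asp_auth (fact_src F) \<inter> asp_auth (fact_trg F) \<and>
     (\<forall>s \<in> fact_auth F. \<phi> D s (asp_sentence (fact_src F)) = \<phi> D s (asp_sentence (fact_trg F)))"
proof -
  have "endorses_equiv D s (asp_sentence V) (asp_sentence V') \<longleftrightarrow>
      \<phi> D s (asp_sentence V) = \<phi> D s (asp_sentence V')"
    if "V \<in> Aspects D" "V' \<in> Aspects D" "asp_src V = asp_src V'" "asp_trg V = asp_trg V'"
      "s \<in> asp_auth V" "s \<in> asp_auth V'" for V V' s
    using Aspects_endorses[of V D s] Aspects_endorses[of V' D s] that endorses_equiv_iff
    by (simp add: asp_sentence_def)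
  then show ?thesis
    unfolding Facts_def by blast
qed

lemma id_aspect_Aspects: "N \<in> Types D \<Longrightarrow> id_aspect D N \<in> Aspects D"
  \<comment> \<open>Instantiating the uniqueness postulate at e itself extracts its existence half:
    e is a verb phrase, endorsed on every endorsed noun phrase.\<close>
  using is_of_course_unique[of "is_of_course D"]
  by (auto simp: Aspects_def Types_def id_aspect_def asp_sentence_def)

lemma endorses_comp_aspect:
  assumes "V \<in> Aspects D" "V' \<in> Aspects D" "asp_trg V = asp_src V'"
    and "s \<in> asp_auth V" "s \<in> asp_auth V'"
  shows "endorses D s (asp_sentence (comp_aspect D V V'))"
    and "\<phi> D s (asp_sentence (comp_aspect D V V')) =
      compose (Examples D s (noun (asp_src V))) (\<phi> D s (asp_sentence V')) (\<phi> D s (asp_sentence V))"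
  using Aspects_endorses[OF assms(1,4)] Aspects_endorses[OF assms(2,5)] assms(3)
    endorses_concat[of s "noun (asp_src V)" "verb V" "noun (asp_trg V)"
      "verb V'" "noun (asp_trg V')"]
  by (simp_all add: asp_sentence_def comp_aspect_def)

lemma comp_aspect_Aspects:
  assumes "V \<in> Aspects D" "V' \<in> Aspects D" "asp_trg V = asp_src V'"
  shows "comp_aspect D V V' \<in> Aspects D"
proof -
  have "concat_verb D (verb V) (noun (asp_trg V)) (verb V') \<in> Verbs D"
    using assms
    by (intro concat_verb_closed[of "noun (asp_src V)" _ _ _ "noun (asp_trg V')"])
      (auto simp: Aspects_def Types_def Sentences_def)
  then have "verb (comp_aspect D V V') \<in> Verbs D"
    by (simp add: comp_aspect_def)
  then show ?thesis
    using assms endorses_comp_aspect[OF assms] unfolding Aspects_def by auto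
qed

lemma id_fact_Facts: "V \<in> Aspects D \<Longrightarrow> id_fact V \<in> Facts D"
  by (simp add: Facts_iff)

lemma vcomp_fact_Facts:
  "F1 \<in> Facts D \<Longrightarrow> F2 \<in> Facts D \<Longrightarrow> fact_trg F1 = fact_src F2 \<Longrightarrow> vcomp_fact F2 F1 \<in> Facts D"
  by (auto simp: Facts_iff)

text \<open>Composites of equal functions are equal. The two \<open>compose\<close> terms also
  restrict to the same example set, because the aspects joined by \<open>F\<close> share their
  source type.\<close>

lemma hcomp_fact_Facts:
  assumes "F \<in> Facts D" "F' \<in> Facts D" "asp_trg (fact_src F) = asp_src (fact_src F')"
  shows "hcomp_fact D F F' \<in> Facts D"
  using assms by (auto simp: Facts_iff comp_aspect_Aspects endorses_comp_aspect subset_iff)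

lemma inverse_Facts: "F \<in> Facts D \<Longrightarrow> Fact (fact_trg F) (fact_src F) (fact_auth F) \<in> Facts D"
  by (auto simp: Facts_iff)

text \<open>The inverse is the reversed fact, with the same author set. Both composites keep
  \<open>fact_auth F\<close>, so they are identity facts because this set is the full author set of
  each aspect.\<close>

lemma iso2_Eng:
  assumes "F \<in> Facts D" "asp_auth (fact_src F) = fact_auth F" "asp_auth (fact_trg F) = fact_auth F"
  shows "F \<in> iso2 (Eng D) (fact_src F) (fact_trg F)"
  using assms inverse_Facts[OF assms(1)]
  by (auto simp: iso2_def hom2_Eng vcomp_fact_def id_fact_def intro!: bexI[rotated])

lemma lunit_Facts:
  assumes "V \<in> Aspects D"
  shows "Fact (comp_aspect D (id_aspect D (asp_src V)) V) V (asp_auth V) \<in> Facts D"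
proof -
  have "comp_aspect D (id_aspect D (asp_src V)) V \<in> Aspects D"
    using assms by (simp add: comp_aspect_Aspects id_aspect_Aspects Aspects_endpoints)
  moreover have "endorses_equiv D s
      (asp_sentence (comp_aspect D (id_aspect D (asp_src V)) V)) (asp_sentence V)"
    if "s \<in> asp_auth V" for s
    using Aspects_endorses[OF assms that] is_of_course_left
    by (simp add: asp_sentence_def comp_aspect_def id_aspect_def)
  ultimately show ?thesis
    using assms Aspects_auth[OF assms] by (simp add: Facts_def)
qed

lemma runit_Facts:
  assumes "V \<in> Aspects D"
  shows "Fact (comp_aspect D V (id_aspect D (asp_trg V))) V (asp_auth V) \<in> Facts D"
proof -
  have "comp_aspect D V (id_aspect D (asp_trg V)) \<in> Aspects D"
    using assms by (simp add: comp_aspect_Aspects id_aspect_Aspects Aspects_endpoints)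
  moreover have "endorses_equiv D s
      (asp_sentence (comp_aspect D V (id_aspect D (asp_trg V)))) (asp_sentence V)"
    if "s \<in> asp_auth V" for s
    using Aspects_endorses[OF assms that] is_of_course_right
    by (simp add: asp_sentence_def comp_aspect_def id_aspect_def)
  ultimately show ?thesis
    using assms Aspects_auth[OF assms] by (simp add: Facts_def)
qed

end

theorem proposition2p3p5:
  fixes D :: "('a, 'w, 'x) english_data"
  assumes "english D"
  shows "bicategory (Eng D)"
proof -
  interpret english D by fact
  note cells = hom1_Eng hom2_Eng
  note auths = Facts_auth[THEN subsetD] Aspects_auth[THEN subsetD]
  show ?thesis
  \<comment> \<open>The case numbers follow the order of the axioms of \<open>bicategory\<close>: 14
    is closure under horizontal composition, 17 the associator, 19 to 22 the unit constraints and
    their naturality.\<close>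
  proof (unfold_locales, goal_cases)
    case (14 f a b g c \<alpha> f' \<beta> g')
    then show ?case
      by (auto simp: cells hcomp_fact_Facts)
  next
    case (17 f a b g c h d)
    then have "comp_aspect D (comp_aspect D f g) h \<in> Aspects D"
      by (simp add: cells comp_aspect_Aspects)
    then show ?case
      using iso2_Eng[OF id_fact_Facts] by (simp add: comp_aspect_assoc)
  next
    case (19 f a b)
    then show ?case
      using iso2_Eng[OF lunit_Facts, of f] Aspects_auth[of f] by (auto simp: cells Int_absorb1)
  next
    case (20 f a b \<alpha> f')
    \<comment> \<open>Both sides have author set \<open>fact_auth\<close> of \<alpha>: the other
      sets intersected, those of the two aspects and of the type, contain it.\<close>
    then show ?case
      using Facts_auth[of \<alpha> D] Aspects_auth[of f D]
      by (auto simp: cells Facts_endpoints intro!: fact.expand)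
  next
    case (21 f a b)
    then show ?case
      using iso2_Eng[OF runit_Facts, of f] Aspects_auth[of f] by (auto simp: cells Int_absorb2)
  next
    case (22 f a b \<alpha> f')
    then show ?case
      using Facts_auth[of \<alpha> D] Aspects_auth[of f D]
      by (auto simp: cells Facts_endpoints intro!: fact.expand)
  \<comment> \<open>For the remaining equations, pentagon and triangle included,
    \<open>fact.expand\<close> leaves equality of endpoints and of author sets; \<open>auths\<close>
    absorbs the larger sets in the intersections.\<close>
  qed (auto simp: cells comp_aspect_assoc Aspects_endpoints Facts_endpoints id_aspect_Aspects
      comp_aspect_Aspects id_fact_Facts vcomp_fact_Facts intro!: fact.expand dest: auths)
qed

end
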